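(* Let $x\in\mathcal C$ and assume the Mangasarian–Fromovitz constraint qualification (MFCQ) holds at $x$. Let $(u,v)$ be any solution of the optimization problem $\min_{(u,v)\in K_{\mathrm{proj}}(x)} J(x,u,v)$. Then $\mathcal F(x,u,v)=\mathrm{proj}_{T_{\mathcal C}(x)}(-F(x))$.
   Context: Setting: $F:\mathbb R^n\to\mathbb R^n$ and $g:\mathbb R^n\to\mathbb R^m$ are continuously differentiable, $h(x)=Hx-c_h$ with $H\in\mathbb R^{k\times n}$, $c_h\in\mathbb R^k$, and the set $\mathcal C=\{x\in\mathbb R^n\mid g(x)\le 0,\ h(x)=0\}$ is convex. The set of solutions of the variational inequality (points $x^*\in\mathcal C$ with $(x-x^* )^\top F(x^* )\ge 0$ for all $x\in\mathcal C$) is assumed nonempty. $T_{\mathcal C}(x)$ is the tangent cone of the closed convex set $\mathcal C$ at $x$ (polar of the normal cone $N_{\mathcal C}(x)=\{d\mid d^\top(x'-x)\le 0\ \forall x'\in\mathcal C\}$), and $\mathrm{proj}$ is Euclidean projection. $I_0(x)=\{i\mid g_i(x)=0\}$; $\frac{\partial g}{\partial x},\frac{\partial h}{\partial x}$ are Jacobians at $x$, and $\frac{\partial g_{I_0}}{\partial x}$ is the matrix with rows $\nabla g_i(x)^\top$, $i\in I_0(x)$. MFCQ at $x\in\mathcal C$: the vectors $\nabla h_1(x),\dots,\nabla h_k(x)$ are linearly independent and there is $\xi\in\mathbb R^n$ with $\nabla g_i(x)^\top\xi<0$ for all $i\in I_0(x)$ and $\nabla h_j(x)^\top\xi=0$ for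 all $j$. $\mathcal F(x,u,v)=-F(x)-\sum_{i=1}^m u_i\nabla g_i(x)-\sum_{j=1}^k v_j\nabla h_j(x)$. $K_{\mathrm{proj}}(x)=\{(u,v)\in\mathbb R^m_{\ge0}\times\mathbb R^k\mid \frac{\partial g_{I_0}}{\partial x}\mathcal F(x,u,v)\le 0,\ \frac{\partial h}{\partial x}\mathcal F(x,u,v)=0\}$. $J(x,u,v)=\frac12\big\|\sum_{i=1}^m u_i\nabla g_i(x)+\sum_{j=1}^k v_j\nabla h_j(x)\big\|^2$. *)

theory Defs
  imports "HOL-Analysis.Analysis"
begin

text \<open>
  A map into \<open>\<real>\<^sup>m\<close> is represented by its components \<open>g 0, \<dots>, g (m - 1)\<close>, and a vector of \<open>\<real>\<^sup>m\<close> by a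
  function on \<open>nat\<close> of which only the values below \<open>m\<close> matter; likewise for \<open>k\<close>. Unlike the types
  \<open>real ^ 'm\<close> and \<open>real ^ 'k\<close>, this allows \<open>m = 0\<close> and \<open>k = 0\<close>, i.e. the absence of
  inequality or of equality constraints.
\<close>

definition continuously_differentiable ::
    "('a::real_normed_vector \<Rightarrow> 'b::real_normed_vector) \<Rightarrow> bool" where
  "continuously_differentiable f \<longleftrightarrow>
     (\<exists>f' :: 'a \<Rightarrow> 'a \<Rightarrow>\<^sub>L 'b.
        (\<forall>x. (f has_derivative blinfun_apply (f' x)) (at x)) \<and> continuous_on UNIV f')"

definition gradient :: "(real ^ 'n \<Rightarrow> real) \<Rightarrow> real ^ 'n \<Rightarrow> real ^ 'n" where
  "gradient f x = (THE d. GDERIV f x :> d)"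

definition feasible_set ::
    "nat \<Rightarrow> (nat \<Rightarrow> real ^ 'n \<Rightarrow> real) \<Rightarrow> nat \<Rightarrow> (nat \<Rightarrow> real ^ 'n \<Rightarrow> real) \<Rightarrow> (real ^ 'n) set" where
  "feasible_set m g k h = {x. (\<forall>i<m. g i x \<le> 0) \<and> (\<forall>j<k. h j x = 0)}"

definition VI_solutions :: "(real ^ 'n \<Rightarrow> real ^ 'n) \<Rightarrow> (real ^ 'n) set \<Rightarrow> (real ^ 'n) set" where
  "VI_solutions F C = {xs \<in> C. \<forall>x\<in>C. (x - xs) \<bullet> F xs \<ge> 0}"

definition polar_cone :: "(real ^ 'n) set \<Rightarrow> (real ^ 'n) set" where
  "polar_cone K = {d. \<forall>z\<in>K. d \<bullet> z \<le> 0}"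

definition normal_cone :: "(real ^ 'n) set \<Rightarrow> real ^ 'n \<Rightarrow> (real ^ 'n) set" where
  "normal_cone C x = {d. \<forall>x'\<in>C. d \<bullet> (x' - x) \<le> 0}"

definition tangent_cone :: "(real ^ 'n) set \<Rightarrow> real ^ 'n \<Rightarrow> (real ^ 'n) set" where
  "tangent_cone C x = polar_cone (normal_cone C x)"

definition active_set :: "nat \<Rightarrow> (nat \<Rightarrow> real ^ 'n \<Rightarrow> real) \<Rightarrow> real ^ 'n \<Rightarrow> nat set" where
  "active_set m g x = {i. i < m \<and> g i x = 0}"

text \<open>
  \<open>independent\<close> speaks about a set of vectors; injectivity makes it independence of the
  family \<open>\<nabla>h\<^sub>0(x), \<nabla>h\<^sub>1(x), \<dots>\<close>, so that repeated gradients are excluded.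
\<close>

definition MFCQ ::
    "nat \<Rightarrow> (nat \<Rightarrow> real ^ 'n \<Rightarrow> real) \<Rightarrow> nat \<Rightarrow> (nat \<Rightarrow> real ^ 'n \<Rightarrow> real) \<Rightarrow> real ^ 'n \<Rightarrow> bool" where
  "MFCQ m g k h x \<longleftrightarrow>
     inj_on (\<lambda>j. gradient (h j) x) {..<k} \<and>
     independent ((\<lambda>j. gradient (h j) x) ` {..<k}) \<and>
     (\<exists>\<xi>. (\<forall>i\<in>active_set m g x. gradient (g i) x \<bullet> \<xi> < 0) \<and>
          (\<forall>j<k. gradient (h j) x \<bullet> \<xi> = 0))"

definition flow_field ::
    "(real ^ 'n \<Rightarrow> real ^ 'n) \<Rightarrow> nat \<Rightarrow> (nat \<Rightarrow> real ^ 'n \<Rightarrow> real) \<Rightarrow> nat \<Rightarrow> (nat \<Rightarrow> real ^ 'n \<Rightarrow> real) \<Rightarrow>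
     real ^ 'n \<Rightarrow> (nat \<Rightarrow> real) \<Rightarrow> (nat \<Rightarrow> real) \<Rightarrow> real ^ 'n" where
  "flow_field F m g k h x u v =
     - F x - (\<Sum>i<m. u i *\<^sub>R gradient (g i) x) - (\<Sum>j<k. v j *\<^sub>R gradient (h j) x)"

text \<open>
  The inner products below are the entries of the Jacobians of the active inequality constraints
  and of \<open>h\<close> applied to the vector \<open>flow_field F m g k h x u v\<close>.
\<close>

definition K_proj ::
    "(real ^ 'n \<Rightarrow> real ^ 'n) \<Rightarrow> nat \<Rightarrow> (nat \<Rightarrow> real ^ 'n \<Rightarrow> real) \<Rightarrow> nat \<Rightarrow> (nat \<Rightarrow> real ^ 'n \<Rightarrow> real) \<Rightarrow>
     real ^ 'n \<Rightarrow> ((nat \<Rightarrow> real) \<times> (nat \<Rightarrow> real)) set" where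
  "K_proj F m g k h x =
     {(u, v). (\<forall>i<m. 0 \<le> u i) \<and>
        (\<forall>i\<in>active_set m g x. gradient (g i) x \<bullet> flow_field F m g k h x u v \<le> 0) \<and>
        (\<forall>j<k. gradient (h j) x \<bullet> flow_field F m g k h x u v = 0)}"

definition J_obj ::
    "nat \<Rightarrow> (nat \<Rightarrow> real ^ 'n \<Rightarrow> real) \<Rightarrow> nat \<Rightarrow> (nat \<Rightarrow> real ^ 'n \<Rightarrow> real) \<Rightarrow>
     real ^ 'n \<Rightarrow> (nat \<Rightarrow> real) \<Rightarrow> (nat \<Rightarrow> real) \<Rightarrow> real" where
  "J_obj m g k h x u v =
     (norm ((\<Sum>i<m. u i *\<^sub>R gradient (g i) x) + (\<Sum>j<k. v j *\<^sub>R gradient (h j) x)))\<^sup>2 / 2"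

end

theory Submission
  imports Defs
begin

text \<open>
  Write \<open>L\<close> for the linearized cone at \<open>x\<close> and \<open>K\<close> for the finitely generated (hence closed) cone
  spanned by the active \<open>\<nabla>g\<^sub>i(x)\<close> and all \<open>\<plusminus>\<nabla>h\<^sub>j(x)\<close>. Under MFCQ, \<open>T\<^sub>C(x) = L\<close>, because adding a
  small multiple of the MFCQ direction turns any direction of \<open>L\<close> into a feasible one. If \<open>r\<close> is the
  projection of \<open>-F(x)\<close> on \<open>K\<close>, then \<open>-F(x) - r \<in> L\<close>, so \<open>r\<close> comes from a point of \<open>K\<^sub>p\<^sub>r\<^sub>o\<^sub>j(x)\<close>,
  while \<open>\<parallel>r\<parallel>\<close> is the distance from \<open>-F(x)\<close> to \<open>L\<close>. Conversely every point of \<open>K\<^sub>p\<^sub>r\<^sub>o\<^sub>j(x)\<close> yields an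
  element of \<open>L\<close> whose distance to \<open>-F(x)\<close> is \<open>\<surd>(2J)\<close>; so a minimizer of \<open>J\<close> yields the point of
  \<open>L\<close> closest to \<open>-F(x)\<close>.
\<close>

definition linearized_cone ::
    "nat \<Rightarrow> (nat \<Rightarrow> real ^ 'n \<Rightarrow> real) \<Rightarrow> nat \<Rightarrow> (nat \<Rightarrow> real ^ 'n \<Rightarrow> real) \<Rightarrow> real ^ 'n \<Rightarrow> (real ^ 'n) set" where
  "linearized_cone m g k h x =
     {d. (\<forall>i\<in>active_set m g x. gradient (g i) x \<bullet> d \<le> 0) \<and> (\<forall>j<k. gradient (h j) x \<bullet> d = 0)}"

section \<open>Gradients and derivatives along rays\<close>

lemma gradient_eqI:
  assumes "GDERIV f x :> d"
  shows "gradient f x = d"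
  unfolding gradient_def
proof (rule the_equality, rule assms)
  fix e assume "GDERIV f x :> e"
  then have "(\<lambda>z. z \<bullet> e) = (\<lambda>z. z \<bullet> d)"
    using assms unfolding gderiv_def by (rule has_derivative_unique)
  then show "e = d"
    by (metis vector_eq_ldot)
qed

lemma GDERIV_gradient:
  assumes "continuously_differentiable f"
  shows "GDERIV f x :> gradient f x"
proof -
  obtain f' where f': "(f has_derivative blinfun_apply f') (at x)"
    using assms unfolding continuously_differentiable_def by blast
  \<comment> \<open>The derivative is a linear functional; its adjoint evaluated at 1 is its Riesz
    representative.\<close>
  have "blinfun_apply f' = (\<lambda>z. z \<bullet> adjoint (blinfun_apply f') 1)"
    using adjoint_works[OF has_derivative_linear[OF f'], of _ 1] by auto
  then have "GDERIV f x :> adjoint (blinfun_apply f') 1"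
    using f' unfolding gderiv_def by simp
  then show ?thesis
    using gradient_eqI by metis
qed

lemma gradient_affine:
  assumes "\<And>y. f y = a \<bullet> y - c"
  shows "gradient f x = a"
proof (rule gradient_eqI)
  have "f = (\<lambda>y. a \<bullet> y - c)"
    using assms by auto
  then show "GDERIV f x :> a"
    unfolding gderiv_def by (auto simp: inner_commute intro!: derivative_eq_intros)
qed

lemma DERIV_along_ray:
  assumes "GDERIV f x :> a"
  shows "DERIV (\<lambda>t. f (x + t *\<^sub>R d)) 0 :> a \<bullet> d"
proof -
  have "((\<lambda>t. x + t *\<^sub>R d) has_derivative (\<lambda>t. t *\<^sub>R d)) (at 0)"
    by (auto intro!: derivative_eq_intros)
  moreover have "(f has_derivative (\<lambda>z. z \<bullet> a)) (at (x + 0 *\<^sub>R d))"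
    using assms unfolding gderiv_def by simp
  ultimately have "((\<lambda>t. f (x + t *\<^sub>R d)) has_derivative (\<lambda>t. (t *\<^sub>R d) \<bullet> a)) (at 0)"
    by (rule has_derivative_compose)
  then show ?thesis
    by (simp add: has_field_derivative_def inner_commute mult_commute_abs)
qed

section \<open>Tangent cone and linearized cone\<close>

text \<open>Active inequality gradients and both signs of every equality gradient are normal
  vectors, so a vector polar to the normal cone satisfies the linearized constraints. For an active
  \<open>g i\<close>, a positive slope towards \<open>x'\<close> would make \<open>g i\<close>
  positive on the segment from \<open>x\<close> to \<open>x'\<close>, which lies in the convex set
  \<open>C\<close>.\<close>

lemma tangent_cone_subset_linearized_cone:
  assumes g: "\<And>i. i < m \<Longrightarrow> continuously_differentiable (g i)"
    and h: "\<And>j y. j < k \<Longrightarrow> h j y = H j \<bullet> y - c j"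
    and C: "C = feasible_set m g k h" "convex C" "x \<in> C"
  shows "tangent_cone C x \<subseteq> linearized_cone m g k h x"
proof
  fix d assume d: "d \<in> tangent_cone C x"
  have "gradient (g i) x \<in> normal_cone C x" if i: "i \<in> active_set m g x" for i
    unfolding normal_cone_def
  proof (clarify, rule ccontr)
    fix x' assume x': "x' \<in> C" and "\<not> gradient (g i) x \<bullet> (x' - x) \<le> 0"
    moreover have im: "i < m" "g i x = 0"
      using i by (auto simp: active_set_def)
    ultimately obtain e where e: "e > 0" "\<And>t. 0 < t \<Longrightarrow> t < e \<Longrightarrow> 0 < g i (x + t *\<^sub>R (x' - x))"
      using DERIV_pos_inc_right[OF DERIV_along_ray[OF GDERIV_gradient[OF g[OF im(1)]]], of x "x' - x"]
      by auto
    \<comment> \<open>The bound \<open>e\<close> gives positivity of \<open>g i\<close>; the bound 1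
      keeps the point on the segment.\<close>
    define t where "t = min (e / 2) 1"
    have t: "0 < t" "t < e" "t \<le> 1"
      using e(1) by (auto simp: t_def)
    have "(1 - t) *\<^sub>R x + t *\<^sub>R x' \<in> C"
      using C(2,3) x' t by (simp add: convexD)
    moreover have "(1 - t) *\<^sub>R x + t *\<^sub>R x' = x + t *\<^sub>R (x' - x)"
      by (simp add: algebra_simps)
    ultimately have "g i (x + t *\<^sub>R (x' - x)) \<le> 0"
      using im C(1) by (simp add: feasible_set_def)
    then show False
      using e(2)[OF t(1,2)] by simp
  qed
  moreover have "gradient (h j) x \<in> normal_cone C x \<and> - gradient (h j) x \<in> normal_cone C x"
    if j: "j < k" for j
  proof -
    have "gradient (h j) x = H j"
      using h[OF j] by (rule gradient_affine)
    moreover have "H j \<bullet> y = c j" if "y \<in> C" for y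
      using that h[OF j, of y] C(1) j by (auto simp: feasible_set_def)
    ultimately show ?thesis
      using C(3) by (simp add: normal_cone_def inner_diff_right)
  qed
  ultimately show "d \<in> linearized_cone m g k h x"
    using d unfolding tangent_cone_def polar_cone_def linearized_cone_def mem_Collect_eq
    by (metis inner_commute inner_minus_right neg_le_0_iff_le antisym)
qed

text \<open>Active constraints strictly decrease from 0, inactive ones stay negative by continuity,
  and the affine ones are constant along \<open>d\<close>.\<close>

lemma eventually_feasible_along_ray:
  assumes g: "\<And>i. i < m \<Longrightarrow> continuously_differentiable (g i)"
    and h: "\<And>j y. j < k \<Longrightarrow> h j y = H j \<bullet> y - c j"
    and x: "x \<in> feasible_set m g k h"
    and dg: "\<And>i. i \<in> active_set m g x \<Longrightarrow> gradient (g i) x \<bullet> d < 0"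
    and dh: "\<And>j. j < k \<Longrightarrow> H j \<bullet> d = 0"
  shows "\<forall>\<^sub>F t in at_right 0. x + t *\<^sub>R d \<in> feasible_set m g k h"
proof -
  have "\<forall>\<^sub>F t in at_right 0. g i (x + t *\<^sub>R d) \<le> 0" if i: "i < m" for i
  proof -
    note D = DERIV_along_ray[OF GDERIV_gradient[OF g[OF i]], of x d]
    show ?thesis
    proof (cases "g i x = 0")
      case True
      then have "gradient (g i) x \<bullet> d < 0"
        using dg i by (simp add: active_set_def)
      from DERIV_neg_dec_right[OF D this] show ?thesis
        using True by (force simp: eventually_at_right_field)
    next
      case False
      then have "g i x < 0"
        using x i by (force simp: feasible_set_def)
      moreover have "((\<lambda>t. g i (x + t *\<^sub>R d)) \<longlongrightarrow> g i x) (at_right 0)"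
        using DERIV_isCont[OF D] by (simp add: isCont_def filterlim_at_split)
      ultimately show ?thesis
        by (rule eventually_mono[OF order_tendstoD(2)[rotated]]) simp
    qed
  qed
  then have "\<forall>\<^sub>F t in at_right 0. \<forall>i\<in>{..<m}. g i (x + t *\<^sub>R d) \<le> 0"
    by (intro eventually_ball_finite) auto
  then show ?thesis
    by (rule eventually_mono) (use x in \<open>auto simp: feasible_set_def h dh inner_add_right\<close>)
qed

text \<open>For \<open>e > 0\<close> the perturbed direction \<open>d + e *\<^sub>R \<xi>\<close> is
  strictly decreasing for every active constraint, so it leads into \<open>C\<close> and has
  nonpositive inner product with each normal vector. The limit of vanishing \<open>e\<close> gives
  the same for \<open>d\<close>.\<close>

lemma linearized_cone_subset_tangent_cone:
  assumes g: "\<And>i. i < m \<Longrightarrow> continuously_differentiable (g i)"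
    and h: "\<And>j y. j < k \<Longrightarrow> h j y = H j \<bullet> y - c j"
    and C: "C = feasible_set m g k h" "x \<in> C"
    and mfcq: "MFCQ m g k h x"
  shows "linearized_cone m g k h x \<subseteq> tangent_cone C x"
proof
  fix d assume d: "d \<in> linearized_cone m g k h x"
  have grad_h: "gradient (h j) x = H j" if "j < k" for j
    using h[OF that] by (rule gradient_affine)
  obtain \<xi> where \<xi>: "\<And>i. i \<in> active_set m g x \<Longrightarrow> gradient (g i) x \<bullet> \<xi> < 0"
      "\<And>j. j < k \<Longrightarrow> H j \<bullet> \<xi> = 0"
    using mfcq grad_h unfolding MFCQ_def by force
  show "d \<in> tangent_cone C x"
    unfolding tangent_cone_def polar_cone_def
  proof (intro CollectI ballI)
    fix n assume n: "n \<in> normal_cone C x"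
    have "(d + e *\<^sub>R \<xi>) \<bullet> n \<le> 0" if e: "e > 0" for e
    proof -
      have "\<forall>\<^sub>F t in at_right 0. x + t *\<^sub>R (d + e *\<^sub>R \<xi>) \<in> C"
        unfolding C(1)
      proof (rule eventually_feasible_along_ray[OF g h])
        show "gradient (g i) x \<bullet> (d + e *\<^sub>R \<xi>) < 0" if "i \<in> active_set m g x" for i
          using d \<xi>(1)[OF that] that e
          by (auto simp: linearized_cone_def inner_add_right mult_pos_neg intro: add_nonpos_neg)
        show "H j \<bullet> (d + e *\<^sub>R \<xi>) = 0" if "j < k" for j
          using d \<xi>(2)[OF that] that by (simp add: linearized_cone_def inner_add_right grad_h)
      qed (use C in auto)
      then have "\<forall>\<^sub>F t in at_right (0::real). t > 0 \<and> x + t *\<^sub>R (d + e *\<^sub>R \<xi>) \<in> C"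
        using eventually_at_right_less by (rule eventually_conj[rotated])
      then obtain t where t: "t > 0" "x + t *\<^sub>R (d + e *\<^sub>R \<xi>) \<in> C"
        by (metis (mono_tags, lifting) eventually_happens trivial_limit_at_right_real)
      then have "n \<bullet> (t *\<^sub>R (d + e *\<^sub>R \<xi>)) \<le> 0"
        using n by (fastforce simp: normal_cone_def)
      then show ?thesis
        using t(1) by (simp add: mult_le_0_iff inner_commute)
    qed
    then have "\<forall>\<^sub>F e in at_right 0. (d + e *\<^sub>R \<xi>) \<bullet> n \<le> 0"
      by (auto simp: eventually_at_right_field intro: zero_less_one)
    moreover have "((\<lambda>e. (d + e *\<^sub>R \<xi>) \<bullet> n) \<longlongrightarrow> (d + 0 *\<^sub>R \<xi>) \<bullet> n) (at_right 0)"
      by (intro tendsto_intros)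
    ultimately show "d \<bullet> n \<le> 0"
      by (auto dest!: tendsto_upperbound)
  qed
qed

section \<open>Projection on finitely generated cones\<close>

text \<open>Moreau's conditions: the variational inequality of the projection is tested at 0 and
  \<open>r + r\<close> for orthogonality, and at \<open>z + r\<close> for polarity.\<close>

lemma closest_point_convex_cone:
  fixes K :: "'a::euclidean_space set"
  assumes K: "convex_cone K" "closed K" and r: "r = closest_point K a"
  shows "r \<in> K" "(a - r) \<bullet> r = 0" "\<And>z. z \<in> K \<Longrightarrow> (a - r) \<bullet> z \<le> 0"
proof -
  show rK: "r \<in> K"
    using K r by (simp add: closest_point_in_set convex_cone_nonempty)
  have dot: "(a - r) \<bullet> (z - r) \<le> 0" if "z \<in> K" for z
    using K that unfolding r by (intro closest_point_dot) (auto simp: convex_cone_def)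
  show "(a - r) \<bullet> r = 0"
    using dot[OF convex_cone_contains_0[OF K(1)]] dot[OF convex_cone_add[OF K(1) rK rK]]
    by simp
  show "(a - r) \<bullet> z \<le> 0" if "z \<in> K" for z
    using dot[OF convex_cone_add[OF K(1) that rK]] by simp
qed

lemma convex_cone_combinations:
  fixes a b :: "nat \<Rightarrow> 'a::real_vector"
  shows "convex_cone {(\<Sum>i<m. u i *\<^sub>R a i) + (\<Sum>j<k. v j *\<^sub>R b j) | u v.
    \<forall>i<m. 0 \<le> (u i :: real)}" (is "convex_cone ?K")
  unfolding convex_cone_iff
proof (intro conjI ballI allI impI)
  show "0 \<in> ?K"
    by (intro CollectI exI[of _ "\<lambda>_. 0"]) simp
next
  fix y z assume "y \<in> ?K" "z \<in> ?K"
  then obtain u v u' v' where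
    y: "y = (\<Sum>i<m. u i *\<^sub>R a i) + (\<Sum>j<k. v j *\<^sub>R b j)" "\<forall>i<m. 0 \<le> u i" and
    z: "z = (\<Sum>i<m. u' i *\<^sub>R a i) + (\<Sum>j<k. v' j *\<^sub>R b j)" "\<forall>i<m. 0 \<le> u' i"
    by blast
  show "y + z \<in> ?K"
    by (intro CollectI exI[of _ "\<lambda>i. u i + u' i"] exI[of _ "\<lambda>j. v j + v' j"])
      (use y z in \<open>simp add: scaleR_left_distrib sum.distrib\<close>)
next
  fix y :: 'a and r :: real assume "y \<in> ?K" and r: "0 \<le> r"
  then obtain u v where
    y: "y = (\<Sum>i<m. u i *\<^sub>R a i) + (\<Sum>j<k. v j *\<^sub>R b j)" "\<forall>i<m. 0 \<le> u i"
    by blast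
  show "r *\<^sub>R y \<in> ?K"
    by (intro CollectI exI[of _ "\<lambda>i. r * u i"] exI[of _ "\<lambda>j. r * v j"])
      (use y r in \<open>simp add: scaleR_right_distrib scaleR_sum_right\<close>)
qed

lemma convex_cone_hull_combination:
  fixes a b :: "nat \<Rightarrow> 'a::real_vector"
  assumes "y \<in> convex_cone hull (a ` A \<union> b ` {..<k} \<union> uminus ` b ` {..<k})" and A: "A \<subseteq> {..<m}"
  obtains u v where "y = (\<Sum>i<m. u i *\<^sub>R a i) + (\<Sum>j<k. v j *\<^sub>R b j)"
    "\<forall>i<m. 0 \<le> (u i :: real)"
proof -
  define K where "K = {(\<Sum>i<m. u i *\<^sub>R a i) + (\<Sum>j<k. v j *\<^sub>R b j) | u v.
    \<forall>i<m. 0 \<le> (u i :: real)}"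
  have "a i \<in> K" if "i \<in> A" for i
    unfolding K_def
    by (intro CollectI exI[of _ "\<lambda>l. if l = i then 1 else 0"] exI[of _ "\<lambda>_. 0"])
      (use that A in \<open>auto simp: if_distrib[of "\<lambda>r. r *\<^sub>R _"] sum.delta cong: if_cong\<close>)
  moreover have b: "s *\<^sub>R b j \<in> K" if "j < k" for j s
    unfolding K_def
    by (intro CollectI exI[of _ "\<lambda>_. 0"] exI[of _ "\<lambda>l. if l = j then s else 0"])
      (use that in \<open>auto simp: if_distrib[of "\<lambda>r. r *\<^sub>R _"] sum.delta cong: if_cong\<close>)
  moreover have "b j \<in> K" "- b j \<in> K" if "j < k" for j
    using b[OF that, of 1] b[OF that, of "- 1"] by simp_all
  ultimately have "a ` A \<union> b ` {..<k} \<union> uminus ` b ` {..<k} \<subseteq> K"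
    by auto
  moreover have "convex_cone K"
    unfolding K_def by (rule convex_cone_combinations)
  ultimately have "y \<in> K"
    using assms(1) hull_minimal by blast
  then show ?thesis
    using that unfolding K_def by blast
qed

text \<open>In the square of the norm of \<open>(s - z) + r\<close> the cross term is nonnegative.
  With \<open>r\<close> polar to a cone, this bounds the distance from \<open>s + r\<close> to that
  cone from below.\<close>

lemma norm_le_norm_diff:
  fixes s r z :: "'a::real_inner"
  assumes "s \<bullet> r = 0" "r \<bullet> z \<le> 0"
  shows "norm r \<le> norm (s + r - z)"
proof -
  have "(norm (s + r - z))\<^sup>2 = (norm (s - z))\<^sup>2 + 2 * (s \<bullet> r - r \<bullet> z) + (norm r)\<^sup>2"
    by (simp add: power2_norm_eq_inner algebra_simps inner_commute)
  then have "(norm r)\<^sup>2 \<le> (norm (s + r - z))\<^sup>2"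
    using assms by (simp add: order_trans[of _ 0])
  then show ?thesis
    by simp
qed

lemma convex_closed_tangent_cone: "convex (tangent_cone C x)" "closed (tangent_cone C x)"
proof -
  have *: "tangent_cone C x = (\<Inter>z\<in>normal_cone C x. {d. z \<bullet> d \<le> 0})"
    by (auto simp: tangent_cone_def polar_cone_def inner_commute)
  show "convex (tangent_cone C x)" "closed (tangent_cone C x)"
    unfolding * by (auto intro!: convex_INT closed_INT convex_halfspace_le closed_halfspace_le)
qed

lemma K_proj_iff:
  "(u, v) \<in> K_proj F m g k h x \<longleftrightarrow>
     (\<forall>i<m. 0 \<le> u i) \<and> flow_field F m g k h x u v \<in> linearized_cone m g k h x"
  by (auto simp: K_proj_def linearized_cone_def)

theorem proposition4p2:
  fixes F :: "real ^ 'n \<Rightarrow> real ^ 'n"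
    and m k :: nat
    and g h :: "nat \<Rightarrow> real ^ 'n \<Rightarrow> real"
    and H :: "nat \<Rightarrow> real ^ 'n" and c :: "nat \<Rightarrow> real"
    and C :: "(real ^ 'n) set"
    and x :: "real ^ 'n"
    and u v :: "nat \<Rightarrow> real"
  assumes "continuously_differentiable F"
    and "\<forall>i<m. continuously_differentiable (g i)"
    and "\<forall>j<k. \<forall>y. h j y = H j \<bullet> y - c j"
    and "C = feasible_set m g k h"
    and "convex C"
    and "VI_solutions F C \<noteq> {}"
    and "x \<in> C"
    and "MFCQ m g k h x"
    and "is_arg_min (\<lambda>(u', v'). J_obj m g k h x u' v') (\<lambda>p. p \<in> K_proj F m g k h x) (u, v)"
  shows "flow_field F m g k h x u v = closest_point (tangent_cone C x) (- F x)"
proof -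
  let ?a = "\<lambda>i. gradient (g i) x" and ?b = "\<lambda>j. gradient (h j) x"
  let ?L = "linearized_cone m g k h x" and ?A = "active_set m g x"
  let ?y = "\<lambda>u v. (\<Sum>i<m. u i *\<^sub>R ?a i) + (\<Sum>j<k. v j *\<^sub>R ?b j)"
  have T: "tangent_cone C x = ?L"
    using tangent_cone_subset_linearized_cone[of m g k h H c C x]
      linearized_cone_subset_tangent_cone[of m g k h H c C x] assms by blast
  have flow: "flow_field F m g k h x u v = - F x - ?y u v" for u v
    by (simp add: flow_field_def)
  have A: "?A \<subseteq> {..<m}"
    by (auto simp: active_set_def)
  define S where "S = ?a ` ?A \<union> ?b ` {..<k} \<union> uminus ` ?b ` {..<k}"
  define r where "r = closest_point (convex_cone hull S) (- F x)"
  \<comment> \<open>Moreau decomposition of \<open>- F x\<close>: \<open>r\<close> lies in the hull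
    and \<open>s\<close> in its polar, which is \<open>?L\<close>.\<close>
  define s where "s = - F x - r"
  have "finite S"
    using finite_subset[OF A] by (simp add: S_def)
  then have "closed (convex_cone hull S)"
    by (rule closed_convex_cone_hull)
  note r = closest_point_convex_cone[OF convex_cone_convex_cone_hull this r_def, folded s_def]
  have S_le: "s \<bullet> z \<le> 0" if "z \<in> S" for z
    using r(3)[OF hull_inc[OF that]] .
  then have "s \<bullet> ?a i \<le> 0" if "i \<in> ?A" for i
    using that by (simp add: S_def)
  moreover have "s \<bullet> ?b j \<le> 0" "s \<bullet> - ?b j \<le> 0" if "j < k" for j
    using that by (auto intro!: S_le simp: S_def simp del: inner_minus_right)
  ultimately have sL: "s \<in> ?L"
    by (auto simp: linearized_cone_def inner_commute intro: antisym)
  have r_polar: "r \<bullet> z \<le> 0" if z: "z \<in> ?L" for z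
  proof -
    \<comment> \<open>This half-space is itself a convex cone, so checking the generators
      suffices.\<close>
    have "S \<subseteq> {y. z \<bullet> y \<le> 0}"
      using z by (auto simp: S_def linearized_cone_def inner_commute)
    then have "convex_cone hull S \<subseteq> {y. z \<bullet> y \<le> 0}"
      using convex_cone_halfspace_le by (rule hull_minimal)
    then show ?thesis
      using r(1) by (auto simp: inner_commute)
  qed
  obtain u' v' where r_eq: "r = ?y u' v'" and "\<forall>i<m. 0 \<le> u' i"
    by (rule convex_cone_hull_combination[OF r(1)[unfolded S_def] A])
  \<comment> \<open>With these multipliers the flow field equals \<open>s\<close>, so they compete
    with the minimizer \<open>(u, v)\<close>.\<close>
  then have "(u', v') \<in> K_proj F m g k h x"
    using sL by (simp add: K_proj_iff flow s_def)
  then have "J_obj m g k h x u v \<le> J_obj m g k h x u' v'"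
    using assms(9) by (auto simp: is_arg_min_def not_less)
  then have y_le: "norm (?y u v) \<le> norm r"
    by (simp add: J_obj_def r_eq)
  show ?thesis
  \<comment> \<open>The distance from \<open>- F x\<close> to the flow field is the norm of
    \<open>?y u v\<close>, at most that of \<open>r\<close>, which bounds the distance to every
    \<open>z\<close> in the cone from below.\<close>
  proof (rule closest_point_unique[OF convex_closed_tangent_cone])
    show "flow_field F m g k h x u v \<in> tangent_cone C x"
      using assms(9) by (simp add: T is_arg_min_def K_proj_iff)
    show "\<forall>z\<in>tangent_cone C x. dist (- F x) (flow_field F m g k h x u v) \<le> dist (- F x) z"
    proof
      fix z assume "z \<in> tangent_cone C x"
      then have "norm r \<le> norm (s + r - z)"
        using norm_le_norm_diff[OF r(2) r_polar] T by blast
      then show "dist (- F x) (flow_field F m g k h x u v) \<le> dist (- F x) z"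
        using y_le by (simp add: dist_norm flow s_def)
    qed
  qed
qed

end
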